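(* The convergence of DNPEN (Dirichlet-Neumann Preconditioned Exact Newton), i.e. of Newton's method applied to $\mathcal{F}(\lambda)=0$ with $$\mathcal{F}(\lambda):=\lambda-G(\lambda)=\theta\lambda-\theta\,\text{NtD}_2\left(-\text{DtN}_1(\lambda,\psi_1),\psi_2\right),$$ does not depend on the relaxation parameter $\theta$ in the Dirichlet-Neumann preconditioner.
   Context: Setting. $\Omega\subset\mathbb{R}^d$, $d\in\{1,2,3\}$, is an open bounded domain with polygonal boundary, $f,g$ are given data, and $\mathcal{L}$ is a nonlinear differential operator such that $\mathcal{L}(u)=f$ in $\Omega$, $u=g$ on $\partial\Omega$ has a unique weak solution in a Hilbert space $\mathcal{X}$ (e.g. $H^1(\Omega)$). $\Omega$ is divided into two nonoverlapping subdomains $\Omega_1,\Omega_2$ with common interface $\Gamma=\partial\Omega_j\setminus\partial\Omega$. Put $f_j:=f|_{\Omega_j}$, $g_j:=g|_{\partial\Omega_j\setminus\Gamma}$, $\psi_j:=(f_j,g_j)$ for $j=1,2$. Neumann operators. $\mathcal{N}_j$ denotes the outward nonlinear Neumann (flux) condition on $\Gamma$ for $\Omega_j$, as found through integration by parts of the variational formulation of the PDE; $\mathcal{N}_ju$ is assumed to define a bounded linear functional over $\mathcal{X}$ (for the well-posedness of the Dirichlet-Neumann method). Nonlinear Dirichlet-to-Neumann and Neumann-to-Dirichlet operators. $\text{DtN}_j(\lambda,\psi_j):=\mathcal{N}_ju_j$, where $u_j$ solves $$\mathcal{L}(u_j)=f_j\ \text{in }\Omega_j,\quad u_j=g_j\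 \text{on }\partial\Omega_j\setminus\Gamma,\quad u_j=\lambda\ \text{on }\Gamma;$$ $\text{NtD}_j(\phi,\psi_j):=v_j|_\Gamma$, where $v_j$ solves $$\mathcal{L}(v_j)=f_j\ \text{in }\Omega_j,\quad v_j=g_j\ \text{on }\partial\Omega_j\setminus\Gamma,\quad \mathcal{N}_jv_j=\phi\ \text{on }\Gamma.$$ Nonlinear Dirichlet-Neumann method (the preconditioner) with relaxation parameter $\theta\in(0,1)$: $\lambda^n=G(\lambda^{n-1})$ with $$G(\lambda):=(1-\theta)\lambda+\theta\,\text{NtD}_2\left(-\text{DtN}_1(\lambda,\psi_1),\psi_2\right).$$ DNPEN is Newton's method applied to the fixed point equation of this iteration, that is, $\lambda^{k+1}=\lambda^k-\left(J\mathcal{F}(\lambda^k)\right)^{-1}\mathcal{F}(\lambda^k)$, where $J\mathcal{F}$ denotes the Jacobian of $\mathcal{F}$. *)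

theory Defs
  imports "HOL-Analysis.Analysis"
begin

section \<open>Weak derivatives\<close>

primrec partials :: "'a::euclidean_space list \<Rightarrow> ('a \<Rightarrow> real) \<Rightarrow> 'a \<Rightarrow> real" where
  "partials [] u = u"
| "partials (b # bs) u = (\<lambda>x. frechet_derivative (partials bs u) (at x) b)"

definition test_function :: "'a::euclidean_space set \<Rightarrow> ('a \<Rightarrow> real) \<Rightarrow> bool" where
  "test_function D \<phi> \<longleftrightarrow>
     (\<forall>bs\<in>lists Basis. \<forall>x. partials bs \<phi> differentiable (at x)) \<and>
     compact (closure {x. \<phi> x \<noteq> 0}) \<and> closure {x. \<phi> x \<noteq> 0} \<subseteq> D"

definition locally_integrable :: "'a::euclidean_space set \<Rightarrow> ('a \<Rightarrow> real) \<Rightarrow> bool" where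
  "locally_integrable D u \<longleftrightarrow> (\<forall>K. compact K \<and> K \<subseteq> D \<longrightarrow> set_integrable lebesgue K u)"

definition has_weak_deriv ::
  "'a::euclidean_space set \<Rightarrow> 'a list \<Rightarrow> ('a \<Rightarrow> real) \<Rightarrow> ('a \<Rightarrow> real) \<Rightarrow> bool" where
  "has_weak_deriv D bs u w \<longleftrightarrow>
     locally_integrable D u \<and> locally_integrable D w \<and>
     (\<forall>\<phi>. test_function D \<phi> \<longrightarrow>
        (LINT x:D|lebesgue. u x * partials bs \<phi> x)
          = (- 1) ^ length bs * (LINT x:D|lebesgue. w x * \<phi> x))"

text \<open>Unique up to null sets, so that the integrals below do not depend on the choice.\<close>

definition weak_deriv :: "'a::euclidean_space set \<Rightarrow> 'a list \<Rightarrow> ('a \<Rightarrow> real) \<Rightarrow> 'a \<Rightarrow> real" where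
  "weak_deriv D bs u = (SOME w. has_weak_deriv D bs u w)"

text \<open>Multi-indices of order at most \<open>m\<close> are lists of basis vectors. A mixed derivative is named by
  several lists; this is harmless, since coefficients attached to superfluous names may be zero.\<close>

definition multi_indices :: "nat \<Rightarrow> 'a::euclidean_space list set" where
  "multi_indices m = {bs \<in> lists Basis. length bs \<le> m}"

definition jet :: "nat \<Rightarrow> 'a::euclidean_space set \<Rightarrow> ('a \<Rightarrow> real) \<Rightarrow> 'a \<Rightarrow> 'a list \<Rightarrow> real" where
  "jet m D u x = (\<lambda>bs. if bs \<in> multi_indices m then weak_deriv D bs u x else 0)"

section \<open>Hilbert spaces of functions\<close>

text \<open>The type \<open>'x\<close> is the Hilbert space; \<open>func\<close> realises its elements as functions (modulo null
  sets) on \<open>region\<close>.\<close>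

record ('a, 'x) fspace =
  region :: "'a set"
  func :: "'x \<Rightarrow> 'a \<Rightarrow> real"

definition hilbert_function_space ::
  "nat \<Rightarrow> ('a::euclidean_space, 'x::{real_inner,complete_space}) fspace \<Rightarrow> bool" where
  "hilbert_function_space m X \<longleftrightarrow>
     (\<forall>u v. AE x in lebesgue. x \<in> region X \<longrightarrow> func X (u + v) x = func X u x + func X v x) \<and>
     (\<forall>c u. AE x in lebesgue. x \<in> region X \<longrightarrow> func X (c *\<^sub>R u) x = c * func X u x) \<and>
     (\<forall>u. (AE x in lebesgue. x \<in> region X \<longrightarrow> func X u x = 0) \<longrightarrow> u = 0) \<and>
     (\<forall>u. \<forall>bs\<in>multi_indices m. \<exists>w. has_weak_deriv (region X) bs (func X u) w) \<and>
     (\<forall>\<phi>. test_function (region X) \<phi> \<longrightarrow>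
        (\<exists>u. AE x in lebesgue. x \<in> region X \<longrightarrow> func X u x = \<phi> x)) \<and>
     (\<forall>K. compact K \<and> K \<subseteq> region X \<longrightarrow>
        (\<exists>C. \<forall>u. (LINT x:K|lebesgue. \<bar>func X u x\<bar>) \<le> C * norm u))"

text \<open>\<open>u = 0\<close> on a part \<open>S\<close> of the boundary, in the sense of traces: \<open>u\<close> belongs to the closure in
  the Hilbert space of the functions vanishing near \<open>S\<close>. For \<open>H\<^sup>1\<close> and \<open>S\<close> the whole boundary this
  gives \<open>H\<^sub>0\<^sup>1\<close>. Inhomogeneous conditions \<open>u = g\<close> on \<open>S\<close> are written as \<open>u - g = 0\<close> on \<open>S\<close>,
  boundary data being represented by an extension \<open>g\<close> in the space.\<close>

definition vanishes_on ::
  "('a::euclidean_space, 'x::{real_inner,complete_space}) fspace \<Rightarrow> 'a set \<Rightarrow> 'x \<Rightarrow> bool" where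
  "vanishes_on X S u \<longleftrightarrow>
     u \<in> closure {v. \<exists>U. open U \<and> S \<subseteq> U \<and>
                      (AE x in lebesgue. x \<in> region X \<inter> U \<longrightarrow> func X v x = 0)}"

section \<open>Nonlinear differential operators and weak solutions\<close>

text \<open>The operator
  \<open>L(u) = (\<Sum>\<alpha>. (-1)^\<bar>\<alpha>\<bar> \<partial>\<^sup>\<alpha> (A\<^sub>\<alpha>(x, (\<partial>\<^sup>\<beta> u)\<^sub>\<beta>)))\<close>, with \<open>\<bar>\<alpha>\<bar>, \<bar>\<beta>\<bar> \<le> m\<close>, is given by
  \<open>m = half_order\<close> and the functions \<open>A\<^sub>\<alpha> = coeff \<alpha>\<close>. Integrating by parts \<open>m\<close> times yields
  \<open>weak_form\<close> in the interior.\<close>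

record 'a diff_operator =
  half_order :: nat
  coeff :: "'a list \<Rightarrow> 'a \<Rightarrow> ('a list \<Rightarrow> real) \<Rightarrow> real"

definition weak_integrand ::
  "'a::euclidean_space diff_operator \<Rightarrow> ('a, 'x) fspace \<Rightarrow> 'x \<Rightarrow> 'x \<Rightarrow> 'a \<Rightarrow> real" where
  "weak_integrand L X u v x =
     (\<Sum>\<alpha>\<in>multi_indices (half_order L).
        coeff L \<alpha> x (jet (half_order L) (region X) (func X u) x)
          * weak_deriv (region X) \<alpha> (func X v) x)"

definition weak_form ::
  "'a::euclidean_space diff_operator \<Rightarrow> ('a, 'x) fspace \<Rightarrow> 'x \<Rightarrow> 'x \<Rightarrow> real" where
  "weak_form L X u v = (LINT x:region X|lebesgue. weak_integrand L X u v x)"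

definition residual_defined ::
  "'a::euclidean_space diff_operator \<Rightarrow> ('a, 'x) fspace \<Rightarrow> ('a \<Rightarrow> real) \<Rightarrow> 'x \<Rightarrow> 'x \<Rightarrow> bool" where
  "residual_defined L X f u v \<longleftrightarrow>
     set_integrable lebesgue (region X) (weak_integrand L X u v) \<and>
     set_integrable lebesgue (region X) (\<lambda>x. f x * func X v x)"

definition residual ::
  "'a::euclidean_space diff_operator \<Rightarrow> ('a, 'x) fspace \<Rightarrow> ('a \<Rightarrow> real) \<Rightarrow> 'x \<Rightarrow> 'x \<Rightarrow> real" where
  "residual L X f u v = weak_form L X u v - (LINT x:region X|lebesgue. f x * func X v x)"

definition weak_solution ::
  "'a::euclidean_space diff_operator \<Rightarrow> ('a, 'x::{real_inner,complete_space}) fspace \<Rightarrow>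
     ('a \<Rightarrow> real) \<Rightarrow> 'x \<Rightarrow> bool" where
  "weak_solution L X f u \<longleftrightarrow>
     (\<forall>v. vanishes_on X (frontier (region X)) v \<longrightarrow>
        residual_defined L X f u v \<and> residual L X f u v = 0)"

section \<open>Subdomain problems and the operators DtN and NtD\<close>

text \<open>One subdomain: the function spaces on the whole domain and on the subdomain, the
  restriction between them, and the trace operator from the functions on the whole domain
  with zero boundary values onto the space \<open>'l\<close> of interface functions. Values of \<open>bd_trace\<close>
  outside that subspace are never used.\<close>

record ('a, 'x, 'y, 'l) side =
  oper :: "'a diff_operator"
  whole :: "('a, 'x) fspace"
  part :: "('a, 'y) fspace"
  restr :: "'x \<Rightarrow> 'y"
  bd_trace :: "'x \<Rightarrow> 'l"

definition interface :: "('a::euclidean_space, 'x, 'y, 'l) side \<Rightarrow> 'a set" where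
  "interface S = frontier (region (part S)) - frontier (region (whole S))"

definition outer_boundary :: "('a::euclidean_space, 'x, 'y, 'l) side \<Rightarrow> 'a set" where
  "outer_boundary S = frontier (region (part S)) - interface S"

text \<open>\<open>u = \<lambda>\<close> on the interface. Functions with the prescribed outer boundary values \<open>g\<close> have
  interface traces forming an affine space \<open>g + \<Lambda>\<close>, where \<open>\<Lambda>\<close> consists of the traces of functions
  with zero outer values (such as \<open>H\<^sub>0\<^sub>0\<^sup>1\<^sup>/\<^sup>2\<close> when the interface meets the outer boundary). The
  variable \<open>\<lambda> \<in> \<Lambda>\<close> is therefore the trace measured from that of the extension \<open>g\<close>; if the trace of
  \<open>g\<close> on the interface is zero, it is the trace itself.\<close>

definition interface_value ::
  "('a::euclidean_space, 'x::{real_inner,complete_space}, 'y::{real_inner,complete_space}, 'l) side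
     \<Rightarrow> 'y \<Rightarrow> 'y \<Rightarrow> 'l \<Rightarrow> bool" where
  "interface_value S g u l \<longleftrightarrow>
     (\<exists>w. vanishes_on (whole S) (frontier (region (whole S))) w \<and> bd_trace S w = l \<and>
          vanishes_on (part S) (interface S) (u - (g + restr S w)))"

definition dirichlet_solution ::
  "('a::euclidean_space, 'x::{real_inner,complete_space}, 'y::{real_inner,complete_space}, 'l) side
     \<Rightarrow> 'l \<Rightarrow> ('a \<Rightarrow> real) \<times> 'y \<Rightarrow> 'y \<Rightarrow> bool" where
  "dirichlet_solution S l \<psi> u \<longleftrightarrow>
     weak_solution (oper S) (part S) (fst \<psi>) u \<and>
     vanishes_on (part S) (outer_boundary S) (u - snd \<psi>) \<and>
     interface_value S (snd \<psi>) u l"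

text \<open>The Neumann condition \<open>\<N>(u) = \<phi>\<close> on the interface, for the outward flux: if
  \<open>L(u) = f\<close>, then integration by parts leaves \<open>weak_form u v - \<integral> f v = \<langle>\<N>(u), v\<rangle>\<close> on the
  interface for all test functions \<open>v\<close> vanishing on the outer boundary.\<close>

definition neumann_condition ::
  "('a::euclidean_space, 'x::{real_inner,complete_space}, 'y::{real_inner,complete_space},
     'l::banach) side \<Rightarrow> ('a \<Rightarrow> real) \<Rightarrow> 'y \<Rightarrow> ('l \<Rightarrow>\<^sub>L real) \<Rightarrow> bool" where
  "neumann_condition S f u \<phi> \<longleftrightarrow>
     (\<forall>v \<mu>. vanishes_on (part S) (outer_boundary S) v \<and> interface_value S 0 v \<mu> \<longrightarrow>
        residual_defined (oper S) (part S) f u v \<and>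
        residual (oper S) (part S) f u v = blinfun_apply \<phi> \<mu>)"

definition neumann ::
  "('a::euclidean_space, 'x::{real_inner,complete_space}, 'y::{real_inner,complete_space},
     'l::banach) side \<Rightarrow> ('a \<Rightarrow> real) \<Rightarrow> 'y \<Rightarrow> ('l \<Rightarrow>\<^sub>L real)" where
  "neumann S f u = (THE \<phi>. neumann_condition S f u \<phi>)"

definition neumann_solution ::
  "('a::euclidean_space, 'x::{real_inner,complete_space}, 'y::{real_inner,complete_space},
     'l::banach) side \<Rightarrow> ('l \<Rightarrow>\<^sub>L real) \<Rightarrow> ('a \<Rightarrow> real) \<times> 'y \<Rightarrow> 'y \<Rightarrow> bool" where
  "neumann_solution S \<phi> \<psi> v \<longleftrightarrow>
     weak_solution (oper S) (part S) (fst \<psi>) v \<and>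
     vanishes_on (part S) (outer_boundary S) (v - snd \<psi>) \<and>
     neumann_condition S (fst \<psi>) v \<phi>"

definition DtN ::
  "('a::euclidean_space, 'x::{real_inner,complete_space}, 'y::{real_inner,complete_space},
     'l::banach) side \<Rightarrow> 'l \<Rightarrow> ('a \<Rightarrow> real) \<times> 'y \<Rightarrow> ('l \<Rightarrow>\<^sub>L real)" where
  "DtN S l \<psi> = neumann S (fst \<psi>) (THE u. dirichlet_solution S l \<psi> u)"

definition NtD ::
  "('a::euclidean_space, 'x::{real_inner,complete_space}, 'y::{real_inner,complete_space},
     'l::banach) side \<Rightarrow> ('l \<Rightarrow>\<^sub>L real) \<Rightarrow> ('a \<Rightarrow> real) \<times> 'y \<Rightarrow> 'l" where
  "NtD S \<phi> \<psi> = (THE l. interface_value S (snd \<psi>) (THE v. neumann_solution S \<phi> \<psi> v) l)"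

section \<open>The two-subdomain problem\<close>

record ('a, 'x, 'y, 'z, 'l) dd_problem =
  pde :: "'a diff_operator"
  source :: "'a \<Rightarrow> real"
  bdata :: 'x
  space0 :: "('a, 'x) fspace"
  space1 :: "('a, 'y) fspace"
  space2 :: "('a, 'z) fspace"
  restr1 :: "'x \<Rightarrow> 'y"
  restr2 :: "'x \<Rightarrow> 'z"
  itrace :: "'x \<Rightarrow> 'l"

definition side1 :: "('a, 'x, 'y, 'z, 'l) dd_problem \<Rightarrow> ('a, 'x, 'y, 'l) side" where
  "side1 P = \<lparr>oper = pde P, whole = space0 P, part = space1 P, restr = restr1 P, bd_trace = itrace P\<rparr>"

definition side2 :: "('a, 'x, 'y, 'z, 'l) dd_problem \<Rightarrow> ('a, 'x, 'z, 'l) side" where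
  "side2 P = \<lparr>oper = pde P, whole = space0 P, part = space2 P, restr = restr2 P, bd_trace = itrace P\<rparr>"

definition \<psi>1 :: "('a, 'x, 'y, 'z, 'l) dd_problem \<Rightarrow> ('a \<Rightarrow> real) \<times> 'y" where
  "\<psi>1 P = (restrict (source P) (region (space1 P)), restr1 P (bdata P))"

definition \<psi>2 :: "('a, 'x, 'y, 'z, 'l) dd_problem \<Rightarrow> ('a \<Rightarrow> real) \<times> 'z" where
  "\<psi>2 P = (restrict (source P) (region (space2 P)), restr2 P (bdata P))"

definition polygonal_domain :: "'a::euclidean_space set \<Rightarrow> bool" where
  "polygonal_domain \<Omega> \<longleftrightarrow>
     open \<Omega> \<and> bounded \<Omega> \<and> connected \<Omega> \<and> \<Omega> \<noteq> {} \<and>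
     (\<exists>\<F>. finite \<F> \<and> (\<forall>F\<in>\<F>. polytope F \<and> aff_dim F = int DIM('a) - 1) \<and> frontier \<Omega> = \<Union>\<F>)"

definition nonoverlapping_decomposition ::
  "'a::euclidean_space set \<Rightarrow> 'a set \<Rightarrow> 'a set \<Rightarrow> bool" where
  "nonoverlapping_decomposition \<Omega> \<Omega>1 \<Omega>2 \<longleftrightarrow>
     open \<Omega>1 \<and> open \<Omega>2 \<and> \<Omega>1 \<noteq> {} \<and> \<Omega>2 \<noteq> {} \<and> \<Omega>1 \<subseteq> \<Omega> \<and> \<Omega>2 \<subseteq> \<Omega> \<and> \<Omega>1 \<inter> \<Omega>2 = {} \<and>
     closure \<Omega>1 \<union> closure \<Omega>2 = closure \<Omega> \<and>
     frontier \<Omega>1 - frontier \<Omega> = frontier \<Omega>2 - frontier \<Omega>"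

text \<open>Compatibility of the spaces on the whole domain and on a subdomain: \<open>restr\<close> restricts
  functions, a function has zero trace iff its restriction vanishes on the interface, and every
  subdomain function with zero outer boundary values has an interface trace.\<close>

definition admissible_side ::
  "('a::euclidean_space, 'x::{real_inner,complete_space}, 'y::{real_inner,complete_space},
     'l::banach) side \<Rightarrow> bool" where
  "admissible_side S \<longleftrightarrow>
     hilbert_function_space (half_order (oper S)) (part S) \<and>
     bounded_linear (restr S) \<and>
     (\<forall>u. AE x in lebesgue. x \<in> region (part S) \<longrightarrow>
        func (part S) (restr S u) x = func (whole S) u x) \<and>
     (\<forall>w. vanishes_on (whole S) (frontier (region (whole S))) w \<longrightarrow>
        (bd_trace S w = 0 \<longleftrightarrow> vanishes_on (part S) (interface S) (restr S w))) \<and>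
     (\<forall>v. vanishes_on (part S) (outer_boundary S) v \<longrightarrow> (\<exists>\<mu>. interface_value S 0 v \<mu>))"

text \<open>The last three conjuncts express that \<open>DtN\<close> on the first and \<open>NtD\<close> on the second subdomain
  are defined: unique solvability of the subdomain problems, and boundedness of the flux
  functional. (A functional on the trace space is bounded iff its composition with the surjective
  trace operator is bounded on the Hilbert space.)\<close>

definition dirichlet_neumann_setting ::
  "('a::euclidean_space, 'x::{real_inner,complete_space}, 'y::{real_inner,complete_space},
     'z::{real_inner,complete_space}, 'l::banach) dd_problem \<Rightarrow> bool" where
  "dirichlet_neumann_setting P \<longleftrightarrow>
     DIM('a) \<in> {1, 2, 3} \<and>
     half_order (pde P) \<ge> 1 \<and>
     polygonal_domain (region (space0 P)) \<and>
     nonoverlapping_decomposition (region (space0 P)) (region (space1 P)) (region (space2 P)) \<and>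
     hilbert_function_space (half_order (pde P)) (space0 P) \<and>
     bounded_linear (itrace P) \<and>
     itrace P ` {w. vanishes_on (space0 P) (frontier (region (space0 P))) w} = UNIV \<and>
     admissible_side (side1 P) \<and> admissible_side (side2 P) \<and>
     (\<exists>!u. weak_solution (pde P) (space0 P) (source P) u \<and>
           vanishes_on (space0 P) (frontier (region (space0 P))) (u - bdata P)) \<and>
     (\<forall>l. \<exists>!u. dirichlet_solution (side1 P) l (\<psi>1 P) u) \<and>
     (\<forall>l u. dirichlet_solution (side1 P) l (\<psi>1 P) u \<longrightarrow>
        (\<exists>\<phi>. neumann_condition (side1 P) (fst (\<psi>1 P)) u \<phi>)) \<and>
     (\<forall>\<phi>. \<exists>!v. neumann_solution (side2 P) \<phi> (\<psi>2 P) v)"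

definition DN_map ::
  "('a::euclidean_space, 'x::{real_inner,complete_space}, 'y::{real_inner,complete_space},
     'z::{real_inner,complete_space}, 'l::banach) dd_problem \<Rightarrow> real \<Rightarrow> 'l \<Rightarrow> 'l" where
  "DN_map P \<theta> l =
     (1 - \<theta>) *\<^sub>R l + \<theta> *\<^sub>R NtD (side2 P) (- DtN (side1 P) l (\<psi>1 P)) (\<psi>2 P)"

definition DNPEN_function ::
  "('a::euclidean_space, 'x::{real_inner,complete_space}, 'y::{real_inner,complete_space},
     'z::{real_inner,complete_space}, 'l::banach) dd_problem \<Rightarrow> real \<Rightarrow> 'l \<Rightarrow> 'l" where
  "DNPEN_function P \<theta> l = l - DN_map P \<theta> l"

section \<open>Newton's method\<close>

text \<open>A relation rather than a function: there is no step from \<open>x\<close> if the derivative at \<open>x\<close> does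
  not exist or is not invertible. On a Banach space the inverse is automatically bounded.\<close>

definition newton_step :: "('l::banach \<Rightarrow> 'l) \<Rightarrow> 'l \<Rightarrow> 'l \<Rightarrow> bool" where
  "newton_step F x y \<longleftrightarrow>
     F differentiable (at x) \<and> bij (frechet_derivative F (at x)) \<and>
     y = x - inv (frechet_derivative F (at x)) (F x)"

definition newton_iteration :: "('l::banach \<Rightarrow> 'l) \<Rightarrow> (nat \<Rightarrow> 'l) \<Rightarrow> bool" where
  "newton_iteration F xs \<longleftrightarrow> (\<forall>k. newton_step F (xs k) (xs (Suc k)))"

definition newton_converges :: "('l::banach \<Rightarrow> 'l) \<Rightarrow> 'l \<Rightarrow> 'l \<Rightarrow> bool" where
  "newton_converges F x0 x \<longleftrightarrow>
     (\<exists>xs. newton_iteration F xs \<and> xs 0 = x0 \<and> xs \<longlonglongrightarrow> x)"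

end

theory Submission
  imports Defs
begin

text \<open>The fixed point equations for different \<open>\<theta>\<close> differ only by a nonzero constant factor, and
  this factor cancels between the inverse derivative and the function value in a Newton step.\<close>

lemma newton_step_scaleR_imp:
  fixes F :: "'l::banach \<Rightarrow> 'l"
  assumes c: "c \<noteq> 0" and step: "newton_step F x y"
  shows "newton_step (\<lambda>l. c *\<^sub>R F l) x y"
proof -
  define D where "D = frechet_derivative F (at x)"
  have diff: "F differentiable (at x)" and bij: "bij D"
    and y: "y = x - inv D (F x)"
    using step by (simp_all add: newton_step_def D_def)
  have "(F has_derivative D) (at x)"
    using diff by (simp add: D_def frechet_derivative_works)
  then have deriv: "((\<lambda>l. c *\<^sub>R F l) has_derivative (\<lambda>v. c *\<^sub>R D v)) (at x)"
    by (rule has_derivative_scaleR_right)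
  \<comment> \<open>\<open>frechet_derivative\<close> is a choice; uniqueness of the derivative at a
    point pins it down.\<close>
  have D': "frechet_derivative (\<lambda>l. c *\<^sub>R F l) (at x) = (\<lambda>v. c *\<^sub>R D v)"
    using frechet_derivative_at[OF deriv] by simp
  have "bij (\<lambda>v::'l. c *\<^sub>R v)"
    using c by (intro bij_betw_byWitness[where f' = "\<lambda>v. inverse c *\<^sub>R v"]) auto
  then have bij': "bij (\<lambda>v. c *\<^sub>R D v)"
    using bij_comp[OF bij] by (simp add: comp_def)
  have "D (inv D (F x)) = F x"
    using bij by (simp add: bij_is_surj surj_f_inv_f)
  \<comment> \<open>The factor cancels here: \<open>inv D (F x)\<close> is also a preimage of
    \<open>c *\<^sub>R F x\<close> under the scaled derivative, and by injectivity the only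
    one.\<close>
  then have "inv (\<lambda>v. c *\<^sub>R D v) (c *\<^sub>R F x) = inv D (F x)"
    by (intro inv_f_eq[OF bij_is_inj[OF bij']]) simp
  then show ?thesis
    using deriv bij' y by (auto simp: newton_step_def D' differentiable_def)
qed

text \<open>Scaling back by \<open>inverse c\<close> gives the converse. Stated as an equality of
  relations, it can be used as a rewrite rule.\<close>

lemma newton_step_scaleR:
  fixes F :: "'l::banach \<Rightarrow> 'l"
  assumes "c \<noteq> 0"
  shows "newton_step (\<lambda>l. c *\<^sub>R F l) = newton_step F"
proof (intro ext iffI)
  fix x y
  assume "newton_step (\<lambda>l. c *\<^sub>R F l) x y"
  then show "newton_step F x y"
    using newton_step_scaleR_imp[of "inverse c" "\<lambda>l. c *\<^sub>R F l" x y] assms by simp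
qed (rule newton_step_scaleR_imp[OF assms])

lemma DNPEN_function_eq_scaleR:
  "DNPEN_function P \<theta> =
     (\<lambda>l. \<theta> *\<^sub>R (l - NtD (side2 P) (- DtN (side1 P) l (\<psi>1 P)) (\<psi>2 P)))"
  by (simp add: fun_eq_iff DNPEN_function_def DN_map_def algebra_simps)

theorem theorem2:
  fixes P :: "('a::euclidean_space, 'x::{real_inner,complete_space}, 'y::{real_inner,complete_space},
     'z::{real_inner,complete_space}, 'l::banach) dd_problem"
    and \<theta> \<theta>' :: real
  assumes "dirichlet_neumann_setting P"
    and "0 < \<theta>" "\<theta> < 1" and "0 < \<theta>'" "\<theta>' < 1"
  shows "(\<forall>l. DNPEN_function P \<theta> l =
            \<theta> *\<^sub>R l - \<theta> *\<^sub>R NtD (side2 P) (- DtN (side1 P) l (\<psi>1 P)) (\<psi>2 P)) \<and>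
         (\<forall>x y. newton_step (DNPEN_function P \<theta>) x y \<longleftrightarrow> newton_step (DNPEN_function P \<theta>') x y) \<and>
         (\<forall>xs. newton_iteration (DNPEN_function P \<theta>) xs \<longleftrightarrow>
               newton_iteration (DNPEN_function P \<theta>') xs) \<and>
         (\<forall>x0 x. newton_converges (DNPEN_function P \<theta>) x0 x \<longleftrightarrow>
                 newton_converges (DNPEN_function P \<theta>') x0 x)"
proof -
  \<comment> \<open>Both sides reduce to the Newton step of the same function, free of the
    parameter, because both factors are positive and hence nonzero.\<close>
  have "newton_step (DNPEN_function P \<theta>) = newton_step (DNPEN_function P \<theta>')"
    using assms by (simp add: DNPEN_function_eq_scaleR newton_step_scaleR)
  \<comment> \<open>Iteration and convergence refer to the function only through
    \<open>newton_step\<close>.\<close>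
  then show ?thesis
    by (simp add: newton_converges_def newton_iteration_def DNPEN_function_eq_scaleR
        scaleR_diff_right)
qed

end
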